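(* Let $\Theta\subseteq\mathbb{R}^m$ be convex and compact, contained in a ball of radius $R$, let $\mathcal{A}=\mathbb{R}^n$, and let $f:\Theta\times\mathcal{A}\to\mathbb{R}$ be continuously differentiable in both $\theta$ and $\alpha$. Assume there are constants $L_{11},L_{22},L_{12}$ such that for all $\theta,\theta_1,\theta_2\in\Theta$ and $\alpha,\alpha_1,\alpha_2\in\mathcal{A}$: $\|\nabla_\theta f(\theta_1,\alpha)-\nabla_\theta f(\theta_2,\alpha)\|\le L_{11}\|\theta_1-\theta_2\|$, $\|\nabla_\alpha f(\theta,\alpha_1)-\nabla_\alpha f(\theta,\alpha_2)\|\le L_{22}\|\alpha_1-\alpha_2\|$, $\|\nabla_\alpha f(\theta_1,\alpha)-\nabla_\alpha f(\theta_2,\alpha)\|\le L_{12}\|\theta_1-\theta_2\|$, $\|\nabla_\theta f(\theta,\alpha_1)-\nabla_\theta f(\theta,\alpha_2)\|\le L_{12}\|\alpha_1-\alpha_2\|$. Assume also that there is $\mu>0$ such that for every $\theta\in\Theta$ the function $\alpha\mapsto -f(\theta,\alpha)$ is $\mu$-PL. Let $\theta_0\in\Theta$, $\alpha_0\in\mathcal{A}$ be starting points, and run multi-step gradient descent ascent with step sizes $\eta_1=1/L_{22}$ and $\eta_2=1/L$, where $L=L_{11}+\frac{L_{12}^2}{2\mu}$. Then there are thresholds $N_T(\varepsilon)=\mathcal{O}(\varepsilon^{-2})$ and $N_K(\varepsilon)=\mathcal{O}(\log(\varepsilon^{-1}))$ (hidden constants not depending on $\varepsilon$) such that for any given $\varepsilon\in(0,1)$,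 if $T\ge N_T(\varepsilon)$ and the number $K$ of inner steps satisfies $K\ge N_K(\varepsilon)$, then there exists an iteration $t\in\{0,\dots,T\}$ such that $(\theta_t,\alpha_{t+1})$ is an $\varepsilon$-first-order Nash equilibrium of the game $\min_{\theta\in\Theta}\max_{\alpha\in\mathcal{A}}f(\theta,\alpha)$.
   Context: A differentiable function $h$ with minimum value $h^*=\min_x h(x)$ is $\mu$-PL (Polyak-Łojasiewicz) if $\frac12\|\nabla h(x)\|^2\ge\mu(h(x)-h^* )$ for all $x$. $\varepsilon$-first-order Nash equilibrium: a point $(\theta^*,\alpha^* )\in\Theta\times\mathcal{A}$ with $\mathcal{X}(\theta^*,\alpha^* )\le\varepsilon$ and $\mathcal{Y}(\theta^*,\alpha^* )\le\varepsilon$, where $\mathcal{X}(\theta^*,\alpha^* )=-\min\{\langle\nabla_\theta f(\theta^*,\alpha^* ),\theta-\theta^*\rangle:\theta\in\Theta,\ \|\theta-\theta^*\|\le1\}$ and $\mathcal{Y}(\theta^*,\alpha^* )=\max\{\langle\nabla_\alpha f(\theta^*,\alpha^* ),\alpha-\alpha^*\rangle:\alpha\in\mathcal{A},\ \|\alpha-\alpha^*\|\le1\}$. (For $\mathcal{A}=\mathbb{R}^n$, $\mathcal{Y}(\theta^*,\alpha^* )=\|\nabla_\alpha f(\theta^*,\alpha^* )\|$.) Multi-step gradient descent ascent with $K$ inner steps and step sizes $\eta_1,\eta_2$: for $t=0,1,2,\dots$ set $\alpha_0(\theta_t)=\alpha_t$; for $k=0,\dots,K-1$ set $\alpha_{k+1}(\theta_t)=\alpha_k(\theta_t)+\eta_1\nabla_\alpha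 f(\theta_t,\alpha_k(\theta_t))$; set $\alpha_{t+1}=\alpha_K(\theta_t)$ and $\theta_{t+1}=\mathrm{proj}_\Theta\big(\theta_t-\eta_2\nabla_\theta f(\theta_t,\alpha_K(\theta_t))\big)$, where $\mathrm{proj}_\Theta$ is Euclidean projection onto $\Theta$.
   Formalization: The constants L_11 and L_22 are taken to be positive: with L_11=0 the claim fails (Θ=[-1,1], f=θα-α²/2, L_12=L_22=μ=1, θ_0=1 makes θ_t alternate between ±1), and L_22>0 is needed for η_1=1/L_22. *)

theory Defs
  imports "HOL-Analysis.Analysis" "HOL-Library.Landau_Symbols"
begin

text \<open>
  A gradient is represented by a field of vectors representing the derivative through the inner
  product. Over a constraint set the derivative is taken within that set, which also covers boundary
  points and sets with empty interior.
\<close>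

text \<open>Polyak-Lojasiewicz functions on the whole space; \<open>h x0\<close> is the attained minimum value.\<close>

definition PL :: "real \<Rightarrow> ('a::real_inner \<Rightarrow> real) \<Rightarrow> bool" where
  "PL \<mu> h \<longleftrightarrow>
     (\<exists>Dh x0. (\<forall>x. GDERIV h x :> Dh x) \<and> (\<forall>x. h x0 \<le> h x) \<and>
              (\<forall>x. 1 / 2 * (norm (Dh x))\<^sup>2 \<ge> \<mu> * (h x - h x0)))"

definition C1_partial_gradients ::
    "'a::real_inner set \<Rightarrow> 'b::real_inner set \<Rightarrow> ('a \<Rightarrow> 'b \<Rightarrow> real) \<Rightarrow>
     ('a \<Rightarrow> 'b \<Rightarrow> 'a) \<Rightarrow> ('a \<Rightarrow> 'b \<Rightarrow> 'b) \<Rightarrow> bool" where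
  "C1_partial_gradients S A f G\<^sub>\<theta> G\<^sub>\<alpha> \<longleftrightarrow>
     (\<forall>\<theta>\<in>S. \<forall>\<alpha>\<in>A. ((\<lambda>x. f x \<alpha>) has_derivative (\<lambda>v. inner (G\<^sub>\<theta> \<theta> \<alpha>) v)) (at \<theta> within S)) \<and>
     (\<forall>\<theta>\<in>S. \<forall>\<alpha>\<in>A. ((\<lambda>y. f \<theta> y) has_derivative (\<lambda>v. inner (G\<^sub>\<alpha> \<theta> \<alpha>) v)) (at \<alpha> within A)) \<and>
     continuous_on (S \<times> A) (\<lambda>(\<theta>, \<alpha>). G\<^sub>\<theta> \<theta> \<alpha>) \<and>
     continuous_on (S \<times> A) (\<lambda>(\<theta>, \<alpha>). G\<^sub>\<alpha> \<theta> \<alpha>)"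

text \<open>
  The two first-order optimality measures. For closed \<open>S\<close>, \<open>A\<close> in Euclidean space and a point in
  them, the infimum and supremum below are attained, so they are a minimum and a maximum.
\<close>

definition nash_gap_min :: "'a::real_inner set \<Rightarrow> ('a \<Rightarrow> 'b \<Rightarrow> 'a) \<Rightarrow> 'a \<Rightarrow> 'b \<Rightarrow> real" where
  "nash_gap_min S G\<^sub>\<theta> \<theta>' \<alpha>' =
     - (INF \<theta>\<in>{\<theta>\<in>S. norm (\<theta> - \<theta>') \<le> 1}. inner (G\<^sub>\<theta> \<theta>' \<alpha>') (\<theta> - \<theta>'))"

definition nash_gap_max :: "'b::real_inner set \<Rightarrow> ('a \<Rightarrow> 'b \<Rightarrow> 'b) \<Rightarrow> 'a \<Rightarrow> 'b \<Rightarrow> real" where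
  "nash_gap_max A G\<^sub>\<alpha> \<theta>' \<alpha>' =
     (SUP \<alpha>\<in>{\<alpha>\<in>A. norm (\<alpha> - \<alpha>') \<le> 1}. inner (G\<^sub>\<alpha> \<theta>' \<alpha>') (\<alpha> - \<alpha>'))"

definition first_order_nash ::
    "'a::real_inner set \<Rightarrow> 'b::real_inner set \<Rightarrow> ('a \<Rightarrow> 'b \<Rightarrow> 'a) \<Rightarrow> ('a \<Rightarrow> 'b \<Rightarrow> 'b) \<Rightarrow>
     real \<Rightarrow> 'a \<Rightarrow> 'b \<Rightarrow> bool" where
  "first_order_nash S A G\<^sub>\<theta> G\<^sub>\<alpha> \<epsilon> \<theta> \<alpha> \<longleftrightarrow>
     \<theta> \<in> S \<and> \<alpha> \<in> A \<and> nash_gap_min S G\<^sub>\<theta> \<theta> \<alpha> \<le> \<epsilon> \<and> nash_gap_max A G\<^sub>\<alpha> \<theta> \<alpha> \<le> \<epsilon>"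

primrec inner_ascent :: "('b::real_vector \<Rightarrow> 'b) \<Rightarrow> real \<Rightarrow> 'b \<Rightarrow> nat \<Rightarrow> 'b" where
  "inner_ascent G \<eta> \<alpha> 0 = \<alpha>"
| "inner_ascent G \<eta> \<alpha> (Suc k) =
     inner_ascent G \<eta> \<alpha> k + \<eta> *\<^sub>R G (inner_ascent G \<eta> \<alpha> k)"

text \<open>
  \<open>multistep_gda \<dots> t\<close> is the pair of iterates with index \<open>t\<close>. On a nonempty closed
  convex set, \<open>closest_point S\<close> is the Euclidean projection.
\<close>

primrec multistep_gda ::
    "'a::euclidean_space set \<Rightarrow> ('a \<Rightarrow> 'b::real_vector \<Rightarrow> 'a) \<Rightarrow> ('a \<Rightarrow> 'b \<Rightarrow> 'b) \<Rightarrow>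
     real \<Rightarrow> real \<Rightarrow> nat \<Rightarrow> 'a \<Rightarrow> 'b \<Rightarrow> nat \<Rightarrow> 'a \<times> 'b" where
  "multistep_gda S G\<^sub>\<theta> G\<^sub>\<alpha> \<eta>1 \<eta>2 K \<theta>0 \<alpha>0 0 = (\<theta>0, \<alpha>0)"
| "multistep_gda S G\<^sub>\<theta> G\<^sub>\<alpha> \<eta>1 \<eta>2 K \<theta>0 \<alpha>0 (Suc t) =
     (let (\<theta>, \<alpha>) = multistep_gda S G\<^sub>\<theta> G\<^sub>\<alpha> \<eta>1 \<eta>2 K \<theta>0 \<alpha>0 t;
          \<alpha>' = inner_ascent (G\<^sub>\<alpha> \<theta>) \<eta>1 \<alpha> K
      in (closest_point S (\<theta> - \<eta>2 *\<^sub>R G\<^sub>\<theta> \<theta> \<alpha>'), \<alpha>'))"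

end

theory Submission
  imports Defs
begin

text \<open>
  Let \<open>best x = max\<^sub>y f x y\<close>. Under the PL condition a point \<open>y\<close> has a maximiser of \<open>f x\<close> within
  \<open>norm (G\<^sub>\<alpha> x y) / \<mu>\<close>, and the gap \<open>best x - f x y\<close> dominates \<open>\<mu> / 2\<close> times the squared distance.
  Hence, along \<open>S\<close>, \<open>best\<close> has the first-order upper model \<open>G\<^sub>\<theta> x a\<close>, \<open>a\<close> any maximiser, with
  quadratic constant \<open>(L11 + L12\<^sup>2 / \<mu>) / 2 = L - L11 / 2\<close>. A projected step \<open>\<Delta>\<close> of size \<open>1 / L\<close>
  therefore lowers \<open>best\<close> by \<open>L11 / 4 * (norm \<Delta>)\<^sup>2\<close>, up to an error quadratic in \<open>norm (G\<^sub>\<alpha> x y)\<close>,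
  while the first-order gap in \<open>\<theta>\<close> is at most a constant times \<open>norm \<Delta>\<close>. Inner ascent
  contracts \<open>best x - f x y\<close> linearly, and since \<open>S\<close> is bounded, warm starting keeps this gap bounded
  uniformly in \<open>t\<close>; so \<open>K\<close> of order \<open>ln (1 / \<epsilon>)\<close> makes the error negligible, and not all of the first
  \<open>T\<close> steps can be longer than a multiple of \<open>\<epsilon>\<close>, because \<open>best\<close> is bounded on \<open>S\<close>.
\<close>

section \<open>Lipschitz gradients and the PL inequality for a single function\<close>

text \<open>Restricting to the segment from \<open>x\<close> to \<open>y\<close> reduces the bound
  to one variable. Only derivatives within \<open>S\<close> enter, so boundary points and flat sets
  are covered.\<close>

lemma lipschitz_gradient_quadratic_bound:
  fixes F :: "'a::real_inner \<Rightarrow> real"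
  assumes "convex S" and xy: "x \<in> S" "y \<in> S"
    and F: "\<And>z. z \<in> S \<Longrightarrow> (F has_derivative (\<lambda>v. G z \<bullet> v)) (at z within S)"
    and lip: "\<And>z w. z \<in> S \<Longrightarrow> w \<in> S \<Longrightarrow> norm (G z - G w) \<le> L * norm (z - w)"
  shows "\<bar>F y - F x - G x \<bullet> (y - x)\<bar> \<le> L / 2 * (norm (y - x))\<^sup>2"
proof -
  define p where "p = (\<lambda>s. x + s *\<^sub>R (y - x))"
  have pS: "p s \<in> S" if "s \<in> {0..1}" for s
  proof -
    have "(1 - s) *\<^sub>R x + s *\<^sub>R y \<in> S"
      using that xy \<open>convex S\<close> by (intro convexD_alt) auto
    then show ?thesis by (simp add: p_def algebra_simps)
  qed
  have Fp: "((\<lambda>s. F (p s)) has_derivative (\<lambda>v. G (p s) \<bullet> (v *\<^sub>R (y - x)))) (at s within {0..1})"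
    if "s \<in> {0..1}" for s
  proof -
    have "(p has_derivative (\<lambda>v. v *\<^sub>R (y - x))) (at s within {0..1})"
      unfolding p_def by (auto intro!: derivative_eq_intros)
    moreover have "(F has_derivative (\<lambda>v. G (p s) \<bullet> v)) (at (p s) within p ` {0..1})"
      by (rule has_derivative_subset[OF F[OF pS[OF that]]]) (use pS in auto)
    ultimately show ?thesis
      by (rule has_derivative_in_compose)
  qed
  have slope: "\<bar>(G (p s) - G x) \<bullet> (y - x)\<bar> \<le> L * s * (norm (y - x))\<^sup>2" if "s \<in> {0..1}" for s
  proof -
    have "\<bar>(G (p s) - G x) \<bullet> (y - x)\<bar> \<le> norm (G (p s) - G x) * norm (y - x)"
      by (rule Cauchy_Schwarz_ineq2)
    also have "\<dots> \<le> (L * norm (p s - x)) * norm (y - x)"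
      by (intro mult_right_mono lip pS that xy) auto
    also have "\<dots> = L * s * (norm (y - x))\<^sup>2"
      using that by (simp add: p_def power2_eq_square)
    finally show ?thesis .
  qed
  have bound: "\<sigma> * (F y - F x - G x \<bullet> (y - x)) \<le> L / 2 * (norm (y - x))\<^sup>2"
    if \<sigma>: "\<sigma> = 1 \<or> \<sigma> = -1" for \<sigma> :: real
  proof -
    define \<phi> where "\<phi> = (\<lambda>s. \<sigma> * (F (p s) - s * (G x \<bullet> (y - x))) - L / 2 * s\<^sup>2 * (norm (y - x))\<^sup>2)"
    have "\<exists>s\<in>{0..1}. \<phi> 1 - \<phi> 0 =
        (\<lambda>s v. \<sigma> * (G (p s) \<bullet> (v *\<^sub>R (y - x)) - v * (G x \<bullet> (y - x)))
           - L / 2 * (2 * s * v) * (norm (y - x))\<^sup>2) s (1 - 0)"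
    proof (rule mvt_very_simple)
      fix s :: real assume "0 \<le> s" "s \<le> 1"
      then have "((\<lambda>s. F (p s)) has_derivative (\<lambda>v. G (p s) \<bullet> (v *\<^sub>R (y - x)))) (at s within {0..1})"
        by (intro Fp) auto
      then show "(\<phi> has_derivative (\<lambda>v. \<sigma> * (G (p s) \<bullet> (v *\<^sub>R (y - x)) - v * (G x \<bullet> (y - x)))
           - L / 2 * (2 * s * v) * (norm (y - x))\<^sup>2)) (at s within {0..1})"
        unfolding \<phi>_def
        by (auto intro!: derivative_eq_intros simp: algebra_simps power2_eq_square)
    qed simp
    then obtain s where s: "s \<in> {0..1}"
      and eq: "\<phi> 1 - \<phi> 0 = \<sigma> * ((G (p s) - G x) \<bullet> (y - x)) - L * s * (norm (y - x))\<^sup>2"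
      by (auto simp: algebra_simps)
    have "\<phi> 1 - \<phi> 0 \<le> 0"
      using slope[OF s] \<sigma> unfolding eq by auto
    then show ?thesis
      by (simp add: \<phi>_def p_def algebra_simps)
  qed
  show ?thesis
    using bound[of 1] bound[of "-1"] by (auto simp: abs_if)
qed

text \<open>
  A minimiser \<open>z\<close> of \<open>y \<mapsto> sqrt (h y - h z0) + c * norm (y - x)\<close> must be a minimiser of \<open>h\<close>:
  otherwise the slope of the square root at \<open>z\<close> is at least \<open>sqrt (\<mu> / 2) > c\<close>, and moving along
  the antigradient decreases the sum. This replaces the usual gradient flow argument.
\<close>

lemma PL_minimum_within:
  fixes h :: "'a::euclidean_space \<Rightarrow> real"
  assumes h: "\<And>x. (h has_derivative (\<lambda>v. G x \<bullet> v)) (at x)"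
    and min: "\<And>x. h z0 \<le> h x"
    and PL: "\<And>x. \<mu> * (h x - h z0) \<le> 1 / 2 * (norm (G x))\<^sup>2"
    and c: "0 < c" "c\<^sup>2 < \<mu> / 2"
  shows "\<exists>z. h z = h z0 \<and> c * norm (z - x) \<le> sqrt (h x - h z0)"
proof -
  define F where "F = (\<lambda>y. sqrt (h y - h z0))"
  \<comment> \<open>Outside this ball the penalty alone exceeds \<open>F x\<close>, so a minimiser
    over the compact ball is a global one.\<close>
  define r where "r = F x / c"
  have F0: "F y \<ge> 0" for y using min by (simp add: F_def)
  have "continuous_on UNIV h"
    using h has_derivative_continuous continuous_at_imp_continuous_on by blast
  then have "continuous_on (cball x r) (\<lambda>y. F y + c * norm (y - x))"
    unfolding F_def by (intro continuous_intros) (auto intro: continuous_on_subset)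
  moreover have "x \<in> cball x r" using F0 c by (simp add: r_def)
  ultimately obtain z where z: "z \<in> cball x r"
      "\<And>y. y \<in> cball x r \<Longrightarrow> F z + c * norm (z - x) \<le> F y + c * norm (y - x)"
    using continuous_attains_inf[of "cball x r" "\<lambda>y. F y + c * norm (y - x)"] by auto
  have zx: "F z + c * norm (z - x) \<le> F x"
    using z(2)[OF \<open>x \<in> cball x r\<close>] by simp
  have zmin: "F z + c * norm (z - x) \<le> F y + c * norm (y - x)" for y
  proof (cases "y \<in> cball x r")
    case False
    then have "F x \<le> c * norm (y - x)"
      using c by (simp add: r_def dist_norm norm_minus_commute field_simps)
    then show ?thesis using zx F0[of y] by linarith
  qed (use z in auto)
  have "h z = h z0"
  proof (rule ccontr)
    assume "h z \<noteq> h z0"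
    then have pos: "h z - h z0 > 0" using min[of z] by simp
    define g where "g = (inverse (F z) / 2) *\<^sub>R G z"
    have Fz: "F z > 0" "(F z)\<^sup>2 = h z - h z0" using pos by (auto simp: F_def)
    have "(F has_derivative (\<lambda>v. g \<bullet> v)) (at z)"
      unfolding g_def F_def using pos
      by (auto intro!: derivative_eq_intros h simp: algebra_simps)
    moreover have "((\<lambda>s::real. z - s *\<^sub>R g) has_derivative (\<lambda>s. - s *\<^sub>R g)) (at 0)"
      by (auto intro!: derivative_eq_intros)
    ultimately have "((\<lambda>s. F (z - s *\<^sub>R g)) has_derivative (\<lambda>s. g \<bullet> (- s *\<^sub>R g))) (at 0)"
      using has_derivative_compose[of "\<lambda>s::real. z - s *\<^sub>R g" "\<lambda>s. - s *\<^sub>R g" 0 UNIV F "\<lambda>v. g \<bullet> v"]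
      by simp
    then have "((\<lambda>s. F (z - s *\<^sub>R g)) has_real_derivative - (norm g)\<^sup>2) (at 0)"
      by (rule has_derivative_imp_has_field_derivative) (simp add: power2_norm_eq_inner)
    then have "((\<lambda>s. (F (z - s *\<^sub>R g) - F z) / s) \<longlongrightarrow> - (norm g)\<^sup>2) (at_right 0)"
      using filterlim_mono[OF _ order_refl at_le[of "{0<..}" UNIV "0::real"]]
      by (auto simp: has_field_derivative_iff)
    moreover have "eventually (\<lambda>s. - c * norm g \<le> (F (z - s *\<^sub>R g) - F z) / s) (at_right 0)"
    proof (rule eventually_at_right_less[THEN eventually_mono])
      fix s :: real assume s: "0 < s"
      have "norm (z - s *\<^sub>R g - x) \<le> norm (z - x) + s * norm g"
        using norm_triangle_ineq4[of "z - x" "s *\<^sub>R g"] s by (simp add: algebra_simps)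
      then have "c * norm (z - s *\<^sub>R g - x) \<le> c * (norm (z - x) + s * norm g)"
        using c by (intro mult_left_mono) auto
      then have "F z - c * (s * norm g) \<le> F (z - s *\<^sub>R g)"
        using zmin[of "z - s *\<^sub>R g"] by (simp add: algebra_simps)
      then show "- c * norm g \<le> (F (z - s *\<^sub>R g) - F z) / s"
        using s by (simp add: field_simps)
    qed
    ultimately have "- c * norm g \<le> - (norm g)\<^sup>2"
      by (rule tendsto_lowerbound) simp
    then have "norm g * norm g \<le> c * norm g" by (simp add: power2_eq_square)
    then have "norm g \<le> c"
      using c by (cases "norm g = 0") auto
    then have "(norm g)\<^sup>2 \<le> c\<^sup>2" by (intro power_mono) auto
    moreover have "(norm g)\<^sup>2 = (norm (G z))\<^sup>2 / (4 * (F z)\<^sup>2)"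
      using Fz(1) by (simp add: g_def power_mult_distrib power_divide field_simps)
    ultimately have "(norm (G z))\<^sup>2 \<le> c\<^sup>2 * (4 * (h z - h z0))"
      using Fz pos by (simp add: field_simps)
    moreover have "c\<^sup>2 * (4 * (h z - h z0)) < \<mu> / 2 * (4 * (h z - h z0))"
      using c pos by (intro mult_strict_right_mono) auto
    ultimately show False using PL[of z] by (simp add: algebra_simps)
  qed
  moreover have "c * norm (z - x) \<le> sqrt (h x - h z0)"
    using zx F0[of z] unfolding F_def by linarith
  ultimately show ?thesis by blast
qed

text \<open>\<open>PL_minimum_within\<close> yields a minimiser that depends on \<open>c\<close>,
  with \<open>c\<close> strictly below \<open>sqrt (\<mu> / 2)\<close>. The point of the closed set
  of minimisers closest to \<open>x\<close> satisfies all these bounds at once, so \<open>c\<close>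
  can tend to the limit.\<close>

lemma PL_quadratic_growth:
  fixes h :: "'a::euclidean_space \<Rightarrow> real"
  assumes h: "\<And>x. (h has_derivative (\<lambda>v. G x \<bullet> v)) (at x)"
    and min: "\<And>x. h z0 \<le> h x"
    and PL: "\<And>x. \<mu> * (h x - h z0) \<le> 1 / 2 * (norm (G x))\<^sup>2"
    and "\<mu> > 0"
  shows "\<exists>z. h z = h z0 \<and> \<mu> / 2 * (norm (x - z))\<^sup>2 \<le> h x - h z0"
proof -
  define Z where "Z = {z. h z = h z0}"
  define z where "z = closest_point Z x"
  have "continuous_on UNIV h"
    using h has_derivative_continuous continuous_at_imp_continuous_on by blast
  then have "closed Z" unfolding Z_def
    by (intro closed_Collect_eq) auto
  have "z0 \<in> Z" by (simp add: Z_def)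
  have z: "z \<in> Z" unfolding z_def
    using \<open>closed Z\<close> \<open>z0 \<in> Z\<close> by (intro closest_point_in_set) auto
  have "t * (sqrt (\<mu> / 2) * norm (x - z)) \<le> sqrt (h x - h z0)" if t: "0 < t" "t < 1" for t
  proof -
    define c where "c = t * sqrt (\<mu> / 2)"
    have "t\<^sup>2 < 1" using t by (simp add: power_less_one_iff)
    then have "0 < c" "c\<^sup>2 < \<mu> / 2"
      using t \<open>\<mu> > 0\<close> by (auto simp: c_def power_mult_distrib)
    then obtain w where w: "h w = h z0" "c * norm (w - x) \<le> sqrt (h x - h z0)"
      using PL_minimum_within[OF h min PL] by blast
    have "norm (x - z) \<le> norm (w - x)"
      using closest_point_le[OF \<open>closed Z\<close>, of w x] w
      by (simp add: Z_def z_def dist_norm norm_minus_commute)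
    then have "c * norm (x - z) \<le> c * norm (w - x)"
      using \<open>0 < c\<close> by simp
    with w show ?thesis by (simp add: c_def)
  qed
  then have "sqrt (\<mu> / 2) * norm (x - z) \<le> sqrt (h x - h z0)"
    by (rule field_le_mult_one_interval)
  then have "(sqrt (\<mu> / 2) * norm (x - z))\<^sup>2 \<le> (sqrt (h x - h z0))\<^sup>2"
    using \<open>\<mu> > 0\<close> by (intro power_mono) auto
  then have "\<mu> / 2 * (norm (x - z))\<^sup>2 \<le> h x - h z0"
    using \<open>\<mu> > 0\<close> min[of x] by (simp add: power_mult_distrib)
  with z show ?thesis by (auto simp: Z_def)
qed

section \<open>The game: gap, gradient and distance to the maximisers in \<alpha>\<close>

locale smooth_PL_game =
  fixes S :: "'a::euclidean_space set"
    and f :: "'a \<Rightarrow> 'b::euclidean_space \<Rightarrow> real"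
    and G\<^sub>\<theta> :: "'a \<Rightarrow> 'b \<Rightarrow> 'a" and G\<^sub>\<alpha> :: "'a \<Rightarrow> 'b \<Rightarrow> 'b"
    and L11 L22 L12 \<mu> D :: real
  assumes S: "convex S" "closed S"
    and diameter: "x \<in> S \<Longrightarrow> x' \<in> S \<Longrightarrow> norm (x' - x) \<le> D"
    and deriv_\<theta>: "x \<in> S \<Longrightarrow> ((\<lambda>x. f x y) has_derivative (\<lambda>v. G\<^sub>\<theta> x y \<bullet> v)) (at x within S)"
    and deriv_\<alpha>: "x \<in> S \<Longrightarrow> (f x has_derivative (\<lambda>v. G\<^sub>\<alpha> x y \<bullet> v)) (at y)"
    and lip11: "x \<in> S \<Longrightarrow> x' \<in> S \<Longrightarrow> norm (G\<^sub>\<theta> x y - G\<^sub>\<theta> x' y) \<le> L11 * norm (x - x')"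
    and lip22: "x \<in> S \<Longrightarrow> norm (G\<^sub>\<alpha> x y - G\<^sub>\<alpha> x y') \<le> L22 * norm (y - y')"
    and lip12: "x \<in> S \<Longrightarrow> x' \<in> S \<Longrightarrow> norm (G\<^sub>\<alpha> x y - G\<^sub>\<alpha> x' y) \<le> L12 * norm (x - x')"
    and lip21: "x \<in> S \<Longrightarrow> norm (G\<^sub>\<theta> x y - G\<^sub>\<theta> x y') \<le> L12 * norm (y - y')"
    and pos: "L11 > 0" "L22 > 0" "L12 \<ge> 0" "\<mu> > 0"
    and PL_\<alpha>: "x \<in> S \<Longrightarrow>
      \<exists>a. \<forall>y. f x y \<le> f x a \<and> \<mu> * (f x a - f x y) \<le> 1 / 2 * (norm (G\<^sub>\<alpha> x y))\<^sup>2"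
begin

text \<open>Meaningful only for \<open>x\<close> in \<open>S\<close>, where
  \<open>PL_\<alpha>\<close> supplies a maximiser.\<close>

definition best :: "'a \<Rightarrow> real" where "best x = (SUP y. f x y)"

lemma best_attained:
  assumes "x \<in> S"
  obtains a where "f x a = best x" "\<And>y. f x y \<le> best x"
    "\<And>y. \<mu> * (best x - f x y) \<le> 1 / 2 * (norm (G\<^sub>\<alpha> x y))\<^sup>2"
proof -
  obtain a where a: "\<And>y. f x y \<le> f x a"
      "\<And>y. \<mu> * (f x a - f x y) \<le> 1 / 2 * (norm (G\<^sub>\<alpha> x y))\<^sup>2"
    using PL_\<alpha>[OF assms] by blast
  have "best x = f x a"
    unfolding best_def by (rule cSup_eq_maximum) (use a in auto)
  with a that show ?thesis by auto
qed

lemma le_best: "x \<in> S \<Longrightarrow> f x y \<le> best x"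
  using best_attained by blast

lemma gap_le_gradient:
  assumes "x \<in> S"
  shows "best x - f x y \<le> (norm (G\<^sub>\<alpha> x y))\<^sup>2 / (2 * \<mu>)"
proof -
  have "\<mu> * (best x - f x y) \<le> 1 / 2 * (norm (G\<^sub>\<alpha> x y))\<^sup>2"
    using best_attained[OF assms] by metis
  then show ?thesis using pos by (simp add: field_simps)
qed

lemma ascent_step:
  assumes "x \<in> S"
  shows "f x (y + (1 / L22) *\<^sub>R G\<^sub>\<alpha> x y) \<ge> f x y + (norm (G\<^sub>\<alpha> x y))\<^sup>2 / (2 * L22)"
proof -
  let ?g = "G\<^sub>\<alpha> x y"
  have "\<bar>f x (y + (1 / L22) *\<^sub>R ?g) - f x y - ?g \<bullet> (y + (1 / L22) *\<^sub>R ?g - y)\<bar>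
      \<le> L22 / 2 * (norm (y + (1 / L22) *\<^sub>R ?g - y))\<^sup>2"
    by (rule lipschitz_gradient_quadratic_bound[where S = UNIV and G = "G\<^sub>\<alpha> x"])
      (use assms deriv_\<alpha> lip22 in auto)
  moreover have "?g \<bullet> (y + (1 / L22) *\<^sub>R ?g - y) = (norm ?g)\<^sup>2 / L22"
    by (simp add: power2_norm_eq_inner)
  moreover have "L22 / 2 * (norm (y + (1 / L22) *\<^sub>R ?g - y))\<^sup>2 = (norm ?g)\<^sup>2 / (2 * L22)"
    using pos by (simp add: power_divide power2_eq_square)
  moreover have "(norm ?g)\<^sup>2 / L22 = (norm ?g)\<^sup>2 / (2 * L22) + (norm ?g)\<^sup>2 / (2 * L22)"
    by simp
  ultimately show ?thesis by linarith
qed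

text \<open>An ascent step cannot climb above \<open>best x\<close>. With the converse
  \<open>gap_le_gradient\<close>, the gap and the squared gradient control each other up to
  constants.\<close>

lemma gradient_le_gap:
  assumes "x \<in> S"
  shows "(norm (G\<^sub>\<alpha> x y))\<^sup>2 \<le> 2 * L22 * (best x - f x y)"
proof -
  have "(norm (G\<^sub>\<alpha> x y))\<^sup>2 / (2 * L22) \<le> best x - f x y"
    using ascent_step[OF assms, of y] le_best[OF assms, of "y + (1 / L22) *\<^sub>R G\<^sub>\<alpha> x y"] by linarith
  then show ?thesis using pos by (simp add: field_simps)
qed

lemma gradient_at_maximiser: "x \<in> S \<Longrightarrow> f x a = best x \<Longrightarrow> G\<^sub>\<alpha> x a = 0"
  using gradient_le_gap[of x a] by simp

text \<open>Quadratic growth of \<open>- f x\<close> bounds the distance by the gap, and PL bounds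
  the gap by the gradient.\<close>

lemma near_maximiser:
  assumes "x \<in> S"
  obtains a where "f x a = best x" "\<mu> / 2 * (norm (y - a))\<^sup>2 \<le> best x - f x y"
    "norm (y - a) \<le> norm (G\<^sub>\<alpha> x y) / \<mu>"
proof -
  obtain a0 where a0: "f x a0 = best x"
      "\<And>y. \<mu> * (best x - f x y) \<le> 1 / 2 * (norm (G\<^sub>\<alpha> x y))\<^sup>2"
    using best_attained[OF assms] by metis
  have "\<exists>a. - f x a = - f x a0 \<and> \<mu> / 2 * (norm (y - a))\<^sup>2 \<le> - f x y - - f x a0"
  proof (rule PL_quadratic_growth)
    show "((\<lambda>y. - f x y) has_derivative (\<lambda>v. - G\<^sub>\<alpha> x z \<bullet> v)) (at z)" for z
      using has_derivative_minus[OF deriv_\<alpha>[OF assms, of z]] by simp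
    show "- f x a0 \<le> - f x z" for z using le_best[OF assms] a0 by simp
    show "\<mu> * (- f x z - - f x a0) \<le> 1 / 2 * (norm (- G\<^sub>\<alpha> x z))\<^sup>2" for z
      using a0(2)[of z] a0(1) by (simp add: algebra_simps)
  qed (rule pos)
  then obtain a where a: "f x a = best x" "\<mu> / 2 * (norm (y - a))\<^sup>2 \<le> best x - f x y"
    using a0 by auto
  have "\<mu> / 2 * (norm (y - a))\<^sup>2 \<le> (norm (G\<^sub>\<alpha> x y))\<^sup>2 / (2 * \<mu>)"
    using a(2) gap_le_gradient[OF assms, of y] by linarith
  then have "(\<mu> * norm (y - a))\<^sup>2 \<le> (norm (G\<^sub>\<alpha> x y))\<^sup>2"
    using pos by (simp add: field_simps power2_eq_square)
  then have "\<mu> * norm (y - a) \<le> norm (G\<^sub>\<alpha> x y)"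
    by (rule power2_le_imp_le) simp
  then have "norm (y - a) \<le> norm (G\<^sub>\<alpha> x y) / \<mu>"
    using pos by (simp add: field_simps)
  with a that show ?thesis by blast
qed

text \<open>The gradient at \<open>a\<close> vanishes for \<open>x\<close>, so for \<open>x'\<close>
  it is at most \<open>L12 * norm (x' - x)\<close>, and \<open>near_maximiser\<close> applies at
  \<open>x'\<close>.\<close>

lemma maximiser_moves_lipschitz:
  assumes "x \<in> S" "x' \<in> S" "f x a = best x"
  obtains b where "f x' b = best x'" "norm (b - a) \<le> L12 / \<mu> * norm (x' - x)"
    "\<mu> / 2 * (norm (a - b))\<^sup>2 \<le> best x' - f x' a"
proof -
  obtain b where b: "f x' b = best x'" "norm (a - b) \<le> norm (G\<^sub>\<alpha> x' a) / \<mu>"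
      "\<mu> / 2 * (norm (a - b))\<^sup>2 \<le> best x' - f x' a"
    using near_maximiser[OF assms(2)] by metis
  have "norm (G\<^sub>\<alpha> x' a) \<le> L12 * norm (x' - x)"
    using lip12[OF assms(2,1), of a] gradient_at_maximiser[OF assms(1,3)] by simp
  then have "norm (G\<^sub>\<alpha> x' a) / \<mu> \<le> L12 / \<mu> * norm (x' - x)"
    using pos by (simp add: divide_right_mono)
  then show ?thesis using b that by (simp add: norm_minus_commute)
qed

section \<open>First-order upper model of \<open>best\<close> along \<open>S\<close>\<close>

lemma \<theta>_quadratic_bound:
  assumes "x \<in> S" "x' \<in> S"
  shows "\<bar>f x' y - f x y - G\<^sub>\<theta> x y \<bullet> (x' - x)\<bar> \<le> L11 / 2 * (norm (x' - x))\<^sup>2"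
  by (rule lipschitz_gradient_quadratic_bound[where S = S and F = "\<lambda>x. f x y" and G = "\<lambda>x. G\<^sub>\<theta> x y"])
    (use assms S deriv_\<theta> lip11 in auto)

lemma G\<theta>_change:
  assumes "x \<in> S"
  shows "\<bar>G\<^sub>\<theta> x y \<bullet> v - G\<^sub>\<theta> x y' \<bullet> v\<bar> \<le> L12 * norm (y - y') * norm v"
proof -
  have "\<bar>(G\<^sub>\<theta> x y - G\<^sub>\<theta> x y') \<bullet> v\<bar> \<le> norm (G\<^sub>\<theta> x y - G\<^sub>\<theta> x y') * norm v"
    by (rule Cauchy_Schwarz_ineq2)
  also have "\<dots> \<le> L12 * norm (y - y') * norm v"
    by (intro mult_right_mono lip21 assms) auto
  finally show ?thesis by (simp add: inner_diff_left)
qed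

text \<open>Expand \<open>f\<close> at a maximiser \<open>b\<close> for \<open>x'\<close> that is
  close to \<open>a\<close>, then replace the gradient at \<open>b\<close> by that at
  \<open>a\<close>. The quadratic constant is too large for the step size, but the first-order
  content is all that \<open>danskin_le\<close> needs.\<close>

lemma best_upper_crude:
  assumes "x \<in> S" "x' \<in> S" "f x a = best x"
  shows "best x' \<le> best x + G\<^sub>\<theta> x a \<bullet> (x' - x) + (L11 / 2 + L12\<^sup>2 / \<mu>) * (norm (x' - x))\<^sup>2"
proof -
  obtain b where b: "f x' b = best x'" "norm (b - a) \<le> L12 / \<mu> * norm (x' - x)"
    using maximiser_moves_lipschitz[OF assms] by metis
  have "L12 * norm (b - a) * norm (x' - x) \<le> L12 * (L12 / \<mu> * norm (x' - x)) * norm (x' - x)"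
    using b(2) pos by (intro mult_right_mono mult_left_mono) auto
  then have "G\<^sub>\<theta> x b \<bullet> (x' - x) \<le> G\<^sub>\<theta> x a \<bullet> (x' - x) + L12\<^sup>2 / \<mu> * (norm (x' - x))\<^sup>2"
    using G\<theta>_change[OF assms(1), of b "x' - x" a] by (simp add: power2_eq_square algebra_simps)
  then show ?thesis
    using \<theta>_quadratic_bound[OF assms(1,2), of b] le_best[OF assms(1), of b] b(1)
    unfolding distrib_right by linarith
qed

text \<open>
  A weak form of Danskin's theorem: to first order along the segment from \<open>x\<close> to \<open>x'\<close>, \<open>best\<close> lies
  above the model at \<open>b\<close> and below the model at \<open>a\<close>.
\<close>

lemma danskin_le:
  assumes x: "x \<in> S" "x' \<in> S" and ab: "f x a = best x" "f x b = best x"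
  shows "G\<^sub>\<theta> x b \<bullet> (x' - x) \<le> G\<^sub>\<theta> x a \<bullet> (x' - x)"
proof -
  let ?v = "x' - x"
  \<comment> \<open>The sum of the quadratic constants of the lower model at \<open>b\<close> and
    the upper model at \<open>a\<close>.\<close>
  define C where "C = (L11 + L12\<^sup>2 / \<mu>) * (norm ?v)\<^sup>2"
  have "G\<^sub>\<theta> x b \<bullet> ?v - G\<^sub>\<theta> x a \<bullet> ?v \<le> C * s" if s: "0 < s" "s < 1" for s
  proof -
    define z where "z = x + s *\<^sub>R ?v"
    have "(1 - s) *\<^sub>R x + s *\<^sub>R x' \<in> S"
      using s x S by (intro convexD_alt) auto
    then have z: "z \<in> S" by (simp add: z_def algebra_simps)
    have zx: "z - x = s *\<^sub>R ?v" by (simp add: z_def)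
    have "f z b \<ge> f x b + s * (G\<^sub>\<theta> x b \<bullet> ?v) - L11 / 2 * (s\<^sup>2 * (norm ?v)\<^sup>2)"
      using \<theta>_quadratic_bound[OF x(1) z, of b]
      unfolding zx inner_scaleR_right norm_scaleR power_mult_distrib power2_abs by linarith
    moreover have "best z \<le> best x + s * (G\<^sub>\<theta> x a \<bullet> ?v)
        + (L11 / 2 + L12\<^sup>2 / \<mu>) * (s\<^sup>2 * (norm ?v)\<^sup>2)"
      using best_upper_crude[OF x(1) z ab(1)] unfolding zx by (simp add: power_mult_distrib)
    moreover have "f z b \<le> best z" using le_best[OF z] .
    ultimately have "s * (G\<^sub>\<theta> x b \<bullet> ?v - G\<^sub>\<theta> x a \<bullet> ?v) \<le> s * (C * s)"
      using ab by (simp add: C_def power2_eq_square algebra_simps)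
    then show ?thesis using s by simp
  qed
  then have "eventually (\<lambda>s. G\<^sub>\<theta> x b \<bullet> ?v - G\<^sub>\<theta> x a \<bullet> ?v \<le> C * s) (at_right 0)"
    using eventually_at_right_real[of 0 1] by (auto elim!: eventually_mono)
  moreover have "((\<lambda>s. C * s) \<longlongrightarrow> C * 0) (at_right 0)"
    by (intro tendsto_intros)
  ultimately have "G\<^sub>\<theta> x b \<bullet> ?v - G\<^sub>\<theta> x a \<bullet> ?v \<le> C * 0"
    by (intro tendsto_lowerbound[of "\<lambda>s. C * s" "C * 0" "at_right 0"] trivial_limit_at_right_real)
  then show ?thesis by simp
qed

text \<open>By symmetry, all maximisers at \<open>x\<close> give the same gradient component along
  \<open>S\<close>. Estimates can thus use whichever maximiser is closest.\<close>

lemma danskin: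
  assumes "x \<in> S" "x' \<in> S" "f x a = best x" "f x b = best x"
  shows "G\<^sub>\<theta> x b \<bullet> (x' - x) = G\<^sub>\<theta> x a \<bullet> (x' - x)"
  using danskin_le[OF assms] danskin_le[OF assms(1,2,4,3)] by simp

text \<open>
  The gap that the maximiser \<open>b\<close> at \<open>x'\<close> leaves at \<open>x\<close> pays for half of the quadratic term; without
  this gain, the step size \<open>1 / (L11 + L12\<^sup>2 / (2 * \<mu>))\<close> would be too long.
\<close>

lemma best_upper:
  assumes x: "x \<in> S" "x' \<in> S" and a: "f x a = best x"
  shows "best x' \<le> best x + G\<^sub>\<theta> x a \<bullet> (x' - x) + (L11 + L12\<^sup>2 / \<mu>) / 2 * (norm (x' - x))\<^sup>2"
proof -
  obtain b where b: "f x' b = best x'"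
    using best_attained[OF x(2)] by metis
  \<comment> \<open>\<open>c\<close> is close to \<open>b\<close> but may differ from
    \<open>a\<close>; \<open>danskin\<close> exchanges the two in the linear term.\<close>
  obtain c where c: "f x c = best x" "\<mu> / 2 * (norm (b - c))\<^sup>2 \<le> best x - f x b"
    using near_maximiser[OF x(1)] by metis
  have "0 \<le> (\<mu> * norm (b - c) - L12 * norm (x' - x))\<^sup>2 / (2 * \<mu>)"
    using pos by simp
  also have "\<dots> = \<mu> / 2 * (norm (b - c))\<^sup>2 - L12 * norm (b - c) * norm (x' - x)
      + L12\<^sup>2 / \<mu> / 2 * (norm (x' - x))\<^sup>2"
    using pos by (simp add: field_simps power2_eq_square)
  finally have "f x b + L12 * norm (b - c) * norm (x' - x)
      \<le> best x + L12\<^sup>2 / \<mu> / 2 * (norm (x' - x))\<^sup>2"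
    using c(2) by linarith
  then show ?thesis
    using \<theta>_quadratic_bound[OF x, of b] G\<theta>_change[OF x(1), of b "x' - x" c] b
      danskin[OF x a c(1)]
    unfolding add_divide_distrib distrib_right by linarith
qed

text \<open>Compare first with a maximiser near \<open>y\<close>, then pass to \<open>a\<close> by
  \<open>danskin\<close>, which identifies only components along \<open>S\<close>.\<close>

lemma tangential_error:
  assumes "x \<in> S" "x' \<in> S" "f x a = best x"
  shows "\<bar>G\<^sub>\<theta> x y \<bullet> (x' - x) - G\<^sub>\<theta> x a \<bullet> (x' - x)\<bar>
    \<le> L12 / \<mu> * norm (G\<^sub>\<alpha> x y) * norm (x' - x)"
proof -
  obtain b where b: "f x b = best x" "norm (y - b) \<le> norm (G\<^sub>\<alpha> x y) / \<mu>"
    using near_maximiser[OF assms(1)] by metis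
  have "L12 * norm (y - b) * norm (x' - x) \<le> L12 * (norm (G\<^sub>\<alpha> x y) / \<mu>) * norm (x' - x)"
    using b(2) pos by (intro mult_right_mono mult_left_mono) auto
  then show ?thesis
    using G\<theta>_change[OF assms(1), of y "x' - x" b] danskin[OF assms(1,2) b(1) assms(3)] by simp
qed

text \<open>
  The iterates in \<open>\<alpha>\<close> and hence the vectors \<open>G\<^sub>\<theta> x y\<close> themselves need not stay bounded; only their
  components along \<open>S\<close> do.
\<close>

lemma tangential_bound:
  assumes "x0 \<in> S"
  obtains B where "B \<ge> 0" "\<And>x x' y. x \<in> S \<Longrightarrow> x' \<in> S \<Longrightarrow>
    \<bar>G\<^sub>\<theta> x y \<bullet> (x' - x)\<bar> \<le> (B + L12 / \<mu> * norm (G\<^sub>\<alpha> x y)) * norm (x' - x)"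
proof -
  obtain a0 where a0: "f x0 a0 = best x0"
    using best_attained[OF assms] by metis
  have "D \<ge> 0" using diameter[OF assms assms] by simp
  \<comment> \<open>Bounds the gradient at suitable maximisers: its norm at \<open>x0\<close>, plus
    the effect of moving \<open>x0\<close> by at most \<open>D\<close>, plus that of the maximiser
    moving by at most \<open>L12 / \<mu> * D\<close>.\<close>
  define B where "B = norm (G\<^sub>\<theta> x0 a0) + (L11 * D + L12 * (L12 / \<mu> * D))"
  have "B \<ge> 0" using pos \<open>D \<ge> 0\<close> by (simp add: B_def)
  moreover have "\<bar>G\<^sub>\<theta> x y \<bullet> (x' - x)\<bar> \<le> (B + L12 / \<mu> * norm (G\<^sub>\<alpha> x y)) * norm (x' - x)"
    if x: "x \<in> S" "x' \<in> S" for x x' y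
  proof -
    obtain a where a: "f x a = best x" "norm (a - a0) \<le> L12 / \<mu> * norm (x - x0)"
      using maximiser_moves_lipschitz[OF assms x(1) a0] by metis
    have "norm (G\<^sub>\<theta> x a) \<le> norm (G\<^sub>\<theta> x0 a0) + norm (G\<^sub>\<theta> x a - G\<^sub>\<theta> x0 a) + norm (G\<^sub>\<theta> x0 a - G\<^sub>\<theta> x0 a0)"
      using norm_triangle_ineq[of "G\<^sub>\<theta> x0 a0" "G\<^sub>\<theta> x a - G\<^sub>\<theta> x0 a0"]
        norm_triangle_ineq[of "G\<^sub>\<theta> x a - G\<^sub>\<theta> x0 a" "G\<^sub>\<theta> x0 a - G\<^sub>\<theta> x0 a0"] by simp
    moreover have "norm (G\<^sub>\<theta> x a - G\<^sub>\<theta> x0 a) \<le> L11 * D"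
      using lip11[OF x(1) assms, of a] mult_left_mono[OF diameter[OF assms x(1)], of L11] pos
      by linarith
    moreover have "norm (a - a0) \<le> L12 / \<mu> * D"
      using a(2) mult_left_mono[OF diameter[OF assms x(1)], of "L12 / \<mu>"] pos by simp
    then have "norm (G\<^sub>\<theta> x0 a - G\<^sub>\<theta> x0 a0) \<le> L12 * (L12 / \<mu> * D)"
      using lip21[OF assms, of a a0] mult_left_mono[of "norm (a - a0)" "L12 / \<mu> * D" L12] pos
      by linarith
    ultimately have "norm (G\<^sub>\<theta> x a) \<le> B" unfolding B_def by linarith
    then have "\<bar>G\<^sub>\<theta> x a \<bullet> (x' - x)\<bar> \<le> B * norm (x' - x)"
      using Cauchy_Schwarz_ineq2[of "G\<^sub>\<theta> x a" "x' - x"]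
        mult_right_mono[of "norm (G\<^sub>\<theta> x a)" B "norm (x' - x)"] by simp
    then show ?thesis
      using tangential_error[OF x a(1), of y] unfolding distrib_right by linarith
  qed
  ultimately show ?thesis by (rule that)
qed

text \<open>Provides the budget for the total decrease of \<open>best\<close>. At a maximiser
  \<open>G\<^sub>\<alpha>\<close> vanishes, so both terms of \<open>best_upper\<close> are bounded
  through \<open>D\<close>.\<close>

lemma best_oscillation:
  assumes "x0 \<in> S"
  obtains C where "C \<ge> 0" "\<And>x x'. x \<in> S \<Longrightarrow> x' \<in> S \<Longrightarrow> best x' - best x \<le> C"
proof -
  obtain B where B: "B \<ge> 0" "\<And>x x' y. x \<in> S \<Longrightarrow> x' \<in> S \<Longrightarrow>
      \<bar>G\<^sub>\<theta> x y \<bullet> (x' - x)\<bar> \<le> (B + L12 / \<mu> * norm (G\<^sub>\<alpha> x y)) * norm (x' - x)"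
    using tangential_bound[OF assms] by blast
  have "D \<ge> 0" using diameter[OF assms assms] by simp
  define C where "C = B * D + (L11 + L12\<^sup>2 / \<mu>) / 2 * D\<^sup>2"
  have "C \<ge> 0" using pos \<open>D \<ge> 0\<close> B by (simp add: C_def)
  moreover have "best x' - best x \<le> C" if x: "x \<in> S" "x' \<in> S" for x x'
  proof -
    obtain a where a: "f x a = best x"
      using best_attained[OF x(1)] by metis
    have "G\<^sub>\<theta> x a \<bullet> (x' - x) \<le> B * norm (x' - x)"
      using B(2)[OF x, of a] gradient_at_maximiser[OF x(1) a] by simp
    also have "\<dots> \<le> B * D"
      using diameter[OF x] B by (intro mult_left_mono) auto
    finally have "G\<^sub>\<theta> x a \<bullet> (x' - x) \<le> B * D" .
    moreover have "(L11 + L12\<^sup>2 / \<mu>) / 2 * (norm (x' - x))\<^sup>2 \<le> (L11 + L12\<^sup>2 / \<mu>) / 2 * D\<^sup>2"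
      using diameter[OF x] pos by (intro mult_left_mono power_mono) auto
    ultimately show ?thesis
      using best_upper[OF x a] unfolding C_def by linarith
  qed
  ultimately show ?thesis by (rule that)
qed

section \<open>One projected step: descent of \<open>best\<close> and first-order gaps\<close>

text \<open>The obtuse angle criterion for projections, scaled by \<open>L\<close>.\<close>

lemma projected_step_variational:
  assumes "L > 0" "x' = closest_point S (x - (1 / L) *\<^sub>R g)" "z \<in> S"
  shows "L * ((x - x') \<bullet> (z - x')) \<le> g \<bullet> (z - x')"
proof -
  have "(x - (1 / L) *\<^sub>R g - x') \<bullet> (z - x') \<le> 0"
    using closest_point_dot[OF S assms(3)] assms(2) by simp
  then have "(x - x') \<bullet> (z - x') \<le> (g \<bullet> (z - x')) / L"
    by (simp add: inner_diff_left)
  then show ?thesis using \<open>L > 0\<close> by (simp add: field_simps)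
qed

text \<open>The step gains \<open>L * (norm (x' - x))\<^sup>2\<close> in the linear term, which
  exceeds the quadratic term of \<open>best_upper\<close> by
  \<open>L11 / 2 * (norm (x' - x))\<^sup>2\<close>. Half of this surplus absorbs the error of using
  \<open>y\<close> instead of a maximiser, by completing a square.\<close>

lemma descent_step:
  assumes x: "x \<in> S" and L: "L = L11 + L12\<^sup>2 / (2 * \<mu>)"
    and x': "x' = closest_point S (x - (1 / L) *\<^sub>R G\<^sub>\<theta> x y)"
  shows "best x' \<le> best x - L11 / 4 * (norm (x' - x))\<^sup>2 + (L12 / \<mu> * norm (G\<^sub>\<alpha> x y))\<^sup>2 / L11"
proof -
  have "L > 0" using pos by (simp add: L add_pos_nonneg)
  have x'S: "x' \<in> S" unfolding x' using x S by (intro closest_point_in_set) auto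
  obtain a where a: "f x a = best x"
    using best_attained[OF x] by metis
  define e where "e = L12 / \<mu> * norm (G\<^sub>\<alpha> x y)"
  have "G\<^sub>\<theta> x y \<bullet> (x' - x) \<le> - (L * (norm (x' - x))\<^sup>2)"
    using projected_step_variational[OF \<open>L > 0\<close> x' x]
    by (simp add: power2_norm_eq_inner inner_diff_left inner_diff_right inner_commute algebra_simps)
  moreover have "L * (norm (x' - x))\<^sup>2
      = (L11 + L12\<^sup>2 / \<mu>) / 2 * (norm (x' - x))\<^sup>2 + L11 / 2 * (norm (x' - x))\<^sup>2"
    using pos by (simp add: L field_simps)
  moreover have "e * norm (x' - x) \<le> L11 / 4 * (norm (x' - x))\<^sup>2 + e\<^sup>2 / L11"
  proof -
    have "0 \<le> (L11 / 2 * norm (x' - x) - e)\<^sup>2 / L11" using pos by simp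
    also have "\<dots> = L11 / 4 * (norm (x' - x))\<^sup>2 - e * norm (x' - x) + e\<^sup>2 / L11"
      using pos by (simp add: field_simps power2_eq_square)
    finally show ?thesis by linarith
  qed
  moreover have "\<bar>G\<^sub>\<theta> x y \<bullet> (x' - x) - G\<^sub>\<theta> x a \<bullet> (x' - x)\<bar> \<le> e * norm (x' - x)"
    using tangential_error[OF x x'S a, of y] by (simp add: e_def)
  ultimately have "best x' \<le> best x - L11 / 4 * (norm (x' - x))\<^sup>2 + e\<^sup>2 / L11"
    using best_upper[OF x x'S a] by linarith
  then show ?thesis by (simp only: e_def)
qed

text \<open>The variational inequality controls the gradient along \<open>z - x'\<close>, and
  \<open>M\<close> pays for the shift from \<open>x'\<close> back to \<open>x\<close>. As
  \<open>z\<close> ranges over a unit ball, the bound is linear in the step length.\<close>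

lemma nash_gap_min_le:
  assumes x: "x \<in> S" and "L > 0" and x': "x' = closest_point S (x - (1 / L) *\<^sub>R G\<^sub>\<theta> x y)"
    and M: "\<bar>G\<^sub>\<theta> x y \<bullet> (x' - x)\<bar> \<le> M * norm (x' - x)"
  shows "nash_gap_min S G\<^sub>\<theta> x y \<le> (L + M) * norm (x' - x)"
proof -
  have "- ((L + M) * norm (x' - x)) \<le> (INF z\<in>{z\<in>S. norm (z - x) \<le> 1}. G\<^sub>\<theta> x y \<bullet> (z - x))"
  proof (rule cINF_greatest)
    show "{z \<in> S. norm (z - x) \<le> 1} \<noteq> {}" using x by force
    fix z assume z: "z \<in> {z \<in> S. norm (z - x) \<le> 1}"
    have "\<bar>(x - x') \<bullet> (z - x)\<bar> \<le> norm (x' - x) * 1"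
      using Cauchy_Schwarz_ineq2[of "x - x'" "z - x"] z
        mult_left_mono[of "norm (z - x)" 1 "norm (x - x')"] by (simp add: norm_minus_commute)
    moreover have "(x - x') \<bullet> (z - x') = (x - x') \<bullet> (z - x) + (norm (x - x'))\<^sup>2"
      by (simp add: power2_norm_eq_inner algebra_simps)
    ultimately have "- norm (x' - x) \<le> (x - x') \<bullet> (z - x')"
      using zero_le_power2[of "norm (x - x')"] by linarith
    then have "L * - norm (x' - x) \<le> L * ((x - x') \<bullet> (z - x'))"
      using \<open>L > 0\<close> by (intro mult_left_mono) auto
    also have "\<dots> \<le> G\<^sub>\<theta> x y \<bullet> (z - x')"
      using projected_step_variational[OF \<open>L > 0\<close> x'] z by simp
    also have "\<dots> = G\<^sub>\<theta> x y \<bullet> (z - x) - G\<^sub>\<theta> x y \<bullet> (x' - x)"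
      by (simp add: inner_diff_right)
    finally show "- ((L + M) * norm (x' - x)) \<le> G\<^sub>\<theta> x y \<bullet> (z - x)"
      using M unfolding distrib_right by linarith
  qed
  then show ?thesis by (simp add: nash_gap_min_def)
qed

lemma nash_gap_max_le: "nash_gap_max UNIV G\<^sub>\<alpha> x y \<le> norm (G\<^sub>\<alpha> x y)"
  unfolding nash_gap_max_def
proof (rule cSUP_least)
  show "{z \<in> UNIV. norm (z - y) \<le> 1} \<noteq> {}" by (auto intro: exI[of _ y])
  fix z assume "z \<in> {z \<in> UNIV. norm (z - y) \<le> 1}"
  then show "G\<^sub>\<alpha> x y \<bullet> (z - y) \<le> norm (G\<^sub>\<alpha> x y)"
    using norm_cauchy_schwarz[of "G\<^sub>\<alpha> x y" "z - y"]
      mult_left_mono[of "norm (z - y)" 1 "norm (G\<^sub>\<alpha> x y)"] by simp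
qed

section \<open>Inner ascent and warm starts\<close>

text \<open>By PL, the gain of an ascent step is at least \<open>\<mu> / L22\<close> times the
  current gap.\<close>

lemma inner_ascent_gap:
  assumes "x \<in> S" "\<rho> \<ge> 0" "\<rho> \<ge> 1 - \<mu> / L22"
  shows "best x - f x (inner_ascent (G\<^sub>\<alpha> x) (1 / L22) y K) \<le> \<rho> ^ K * (best x - f x y)"
proof (induction K)
  case (Suc K)
  let ?y = "inner_ascent (G\<^sub>\<alpha> x) (1 / L22) y K"
  let ?gap = "best x - f x ?y"
  have "\<mu> / L22 * ?gap \<le> \<mu> / L22 * ((norm (G\<^sub>\<alpha> x ?y))\<^sup>2 / (2 * \<mu>))"
    using gap_le_gradient[OF assms(1), of ?y] pos by (intro mult_left_mono) auto
  also have "\<dots> = (norm (G\<^sub>\<alpha> x ?y))\<^sup>2 / (2 * L22)" using pos by simp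
  finally have "best x - f x (inner_ascent (G\<^sub>\<alpha> x) (1 / L22) y (Suc K)) \<le> (1 - \<mu> / L22) * ?gap"
    using ascent_step[OF assms(1), of ?y] by (simp add: left_diff_distrib)
  also have "\<dots> \<le> \<rho> * ?gap"
    using assms le_best[OF assms(1)] by (intro mult_right_mono) auto
  also have "\<dots> \<le> \<rho> * (\<rho> ^ K * (best x - f x y))"
    using Suc assms by (intro mult_left_mono) auto
  finally show ?case by (simp add: mult.assoc)
qed simp

text \<open>The gap at \<open>x\<close> bounds the gradient there, \<open>lip12\<close> carries this
  bound to \<open>x'\<close>, and PL turns it back into a gap. All constants are uniform in
  \<open>y\<close>.\<close>

lemma warm_start_gap:
  assumes x: "x \<in> S" "x' \<in> S"
  shows "best x' - f x' y \<le> 2 * L22 / \<mu> * (best x - f x y) + (L12 * D)\<^sup>2 / \<mu>"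
proof -
  have "norm (G\<^sub>\<alpha> x' y - G\<^sub>\<alpha> x y) \<le> L12 * D"
    using lip12[OF x(2,1), of y] mult_left_mono[OF diameter[OF x], of L12] pos by linarith
  then have "norm (G\<^sub>\<alpha> x' y) \<le> norm (G\<^sub>\<alpha> x y) + L12 * D"
    using norm_triangle_sub[of "G\<^sub>\<alpha> x' y" "G\<^sub>\<alpha> x y"] by simp
  then have "(norm (G\<^sub>\<alpha> x' y))\<^sup>2 \<le> (norm (G\<^sub>\<alpha> x y) + L12 * D)\<^sup>2"
    by (intro power_mono) auto
  also have "\<dots> \<le> 2 * (norm (G\<^sub>\<alpha> x y))\<^sup>2 + 2 * (L12 * D)\<^sup>2"
    using sum_squares_bound[of "norm (G\<^sub>\<alpha> x y)" "L12 * D"] by (simp add: power2_sum)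
  also have "\<dots> \<le> 2 * (2 * L22 * (best x - f x y)) + 2 * (L12 * D)\<^sup>2"
    using gradient_le_gap[OF x(1), of y] by simp
  finally have "(norm (G\<^sub>\<alpha> x' y))\<^sup>2 / (2 * \<mu>)
      \<le> (2 * (2 * L22 * (best x - f x y)) + 2 * (L12 * D)\<^sup>2) / (2 * \<mu>)"
    using pos by (intro divide_right_mono) auto
  also have "\<dots> = 2 * L22 / \<mu> * (best x - f x y) + (L12 * D)\<^sup>2 / \<mu>"
    by (simp add: add_divide_distrib)
  finally show ?thesis
    using gap_le_gradient[OF x(2), of y] by linarith
qed

section \<open>Counting outer steps\<close>

text \<open>Both constants are fixed before \<epsilon>, \<open>T\<close> and \<open>K\<close>, so
  the thresholds can be read off from the two requirements.\<close>

lemma nash_iterate: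
  assumes x0: "x0 \<in> S" and L: "L = L11 + L12\<^sup>2 / (2 * \<mu>)" and \<rho>: "\<rho> \<ge> 0" "\<rho> \<ge> 1 - \<mu> / L22"
  obtains C c where "C \<ge> 0" "c > 0"
    "\<And>\<epsilon> T K. 0 < \<epsilon> \<Longrightarrow> \<epsilon> < 1 \<Longrightarrow> C / \<epsilon>\<^sup>2 \<le> real T \<Longrightarrow> \<rho> ^ K \<le> c * \<epsilon>\<^sup>2 \<Longrightarrow>
       \<exists>t\<in>{0..T}. first_order_nash S UNIV G\<^sub>\<theta> G\<^sub>\<alpha> \<epsilon>
         (fst (multistep_gda S G\<^sub>\<theta> G\<^sub>\<alpha> (1 / L22) (1 / L) K x0 y0 t))
         (snd (multistep_gda S G\<^sub>\<theta> G\<^sub>\<alpha> (1 / L22) (1 / L) K x0 y0 (Suc t)))"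
proof -
  have "L > 0" using pos by (simp add: L add_pos_nonneg)
  obtain B where B: "B \<ge> 0" "\<And>x x' y. x \<in> S \<Longrightarrow> x' \<in> S \<Longrightarrow>
      \<bar>G\<^sub>\<theta> x y \<bullet> (x' - x)\<bar> \<le> (B + L12 / \<mu> * norm (G\<^sub>\<alpha> x y)) * norm (x' - x)"
    using tangential_bound[OF x0] by blast
  obtain C0 where C0: "C0 \<ge> 0" "\<And>x x'. x \<in> S \<Longrightarrow> x' \<in> S \<Longrightarrow> best x' - best x \<le> C0"
    using best_oscillation[OF x0] by blast
  \<comment> \<open>The factor from step length to first-order gap in
    \<open>nash_gap_min_le\<close>, once the inner gradient has norm at most 1.\<close>
  define M where "M = L + (B + L12 / \<mu>)"
  have "M > 0" using \<open>L > 0\<close> B pos by (simp add: M_def add_pos_nonneg)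
  \<comment> \<open>Chosen to be invariant: it covers the initial gap, and
    \<open>\<Gamma> / 2 + (L12 * D)\<^sup>2 / \<mu> \<le> \<Gamma>\<close>.\<close>
  define \<Gamma> where "\<Gamma> = max (best x0 - f x0 y0) (2 * (L12 * D)\<^sup>2 / \<mu>)"
  have "\<Gamma> \<ge> 0" using le_best[OF x0, of y0] by (simp add: \<Gamma>_def)
  \<comment> \<open>The inner gradient will be at most \<open>\<kappa> * \<epsilon>\<close>: the
    entry 1 serves the gap in \<alpha>, the other the error in \<open>descent_step\<close>. Adding 1
    to \<open>L12\<close> avoids a zero denominator.\<close>
  define \<kappa> where "\<kappa> = min 1 (\<mu> * L11 / (4 * M * (L12 + 1)))"
  have "\<kappa> > 0" "\<kappa> \<le> 1" using pos \<open>M > 0\<close> by (auto simp: \<kappa>_def)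
  have \<kappa>: "L12 / \<mu> * \<kappa> \<le> L11 / (4 * M)"
  proof -
    have "L12 / \<mu> * \<kappa> \<le> L12 / \<mu> * (\<mu> * L11 / (4 * M * (L12 + 1)))"
      using pos by (intro mult_left_mono) (auto simp: \<kappa>_def)
    also have "\<dots> = L12 / (L12 + 1) * (L11 / (4 * M))"
      using pos by simp
    also have "\<dots> \<le> 1 * (L11 / (4 * M))"
      using pos \<open>M > 0\<close> by (intro mult_right_mono) auto
    finally show ?thesis by simp
  qed
  \<comment> \<open>The first entry offsets the factor \<open>2 * L22 / \<mu>\<close> of a warm
    start and leaves \<open>\<Gamma> / 2\<close>; the second brings the inner gradient down to
    \<open>\<kappa> * \<epsilon>\<close>.\<close>
  define c where "c = min (\<mu> / (4 * L22)) (\<kappa>\<^sup>2 / (2 * L22 * (\<Gamma> + 1)))"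
  have "c > 0" using pos \<open>\<kappa> > 0\<close> \<open>\<Gamma> \<ge> 0\<close> by (simp add: c_def)
  define C where "C = 8 * C0 * M\<^sup>2 / L11"
  have "C \<ge> 0" using C0 pos by (simp add: C_def)
  show ?thesis
  proof (rule that[OF \<open>C \<ge> 0\<close> \<open>c > 0\<close>])
    fix \<epsilon> :: real and T K :: nat
    assume \<epsilon>: "0 < \<epsilon>" "\<epsilon> < 1" and T: "C / \<epsilon>\<^sup>2 \<le> real T" and K: "\<rho> ^ K \<le> c * \<epsilon>\<^sup>2"
    define x where "x t = fst (multistep_gda S G\<^sub>\<theta> G\<^sub>\<alpha> (1 / L22) (1 / L) K x0 y0 t)" for t
    define y where "y t = snd (multistep_gda S G\<^sub>\<theta> G\<^sub>\<alpha> (1 / L22) (1 / L) K x0 y0 t)" for t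
    have init: "x 0 = x0" "y 0 = y0" by (auto simp: x_def y_def)
    have y_Suc: "y (Suc t) = inner_ascent (G\<^sub>\<alpha> (x t)) (1 / L22) (y t) K" for t
      by (simp add: x_def y_def Let_def case_prod_beta)
    have x_Suc: "x (Suc t) = closest_point S (x t - (1 / L) *\<^sub>R G\<^sub>\<theta> (x t) (y (Suc t)))" for t
      by (simp add: x_def y_def Let_def case_prod_beta)
    have xS: "x t \<in> S" for t
    proof (cases t)
      case (Suc s)
      show ?thesis unfolding Suc x_Suc using x0 S by (intro closest_point_in_set) auto
    qed (use x0 init in auto)
    have gap0: "best (x t) - f (x t) (y t) \<ge> 0" for t
      using le_best[OF xS] by simp
    have gap_Suc: "best (x t) - f (x t) (y (Suc t)) \<le> \<rho> ^ K * (best (x t) - f (x t) (y t))" for t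
      unfolding y_Suc by (rule inner_ascent_gap[OF xS \<rho>])
    have gap: "best (x t) - f (x t) (y t) \<le> \<Gamma>" for t
    proof (induction t)
      case 0
      show ?case by (simp add: init \<Gamma>_def)
    next
      case (Suc t)
      have "c * \<epsilon>\<^sup>2 \<le> \<mu> / (4 * L22) * 1"
        using \<epsilon> pos \<open>c > 0\<close> by (intro mult_mono power_le_one) (auto simp: c_def)
      then have "\<rho> ^ K \<le> \<mu> / (4 * L22)" using K by simp
      then have "\<rho> ^ K * (best (x t) - f (x t) (y t)) \<le> \<mu> / (4 * L22) * \<Gamma>"
        using Suc gap0[of t] pos by (intro mult_mono) auto
      then have "best (x t) - f (x t) (y (Suc t)) \<le> \<mu> / (4 * L22) * \<Gamma>"
        using gap_Suc[of t] by linarith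
      then have "2 * L22 / \<mu> * (best (x t) - f (x t) (y (Suc t))) \<le> 2 * L22 / \<mu> * (\<mu> / (4 * L22) * \<Gamma>)"
        using pos by (intro mult_left_mono) auto
      also have "\<dots> = \<Gamma> / 2" using pos by simp
      finally have "best (x (Suc t)) - f (x (Suc t)) (y (Suc t)) \<le> \<Gamma> / 2 + (L12 * D)\<^sup>2 / \<mu>"
        using warm_start_gap[OF xS xS, of "Suc t" "y (Suc t)" t] by linarith
      moreover have "2 * (L12 * D)\<^sup>2 / \<mu> \<le> \<Gamma>" by (simp add: \<Gamma>_def)
      ultimately show ?case by simp
    qed
    have \<delta>: "norm (G\<^sub>\<alpha> (x t) (y (Suc t))) \<le> \<kappa> * \<epsilon>" for t
    proof -
      have "c * (\<Gamma> + 1) \<le> \<kappa>\<^sup>2 / (2 * L22 * (\<Gamma> + 1)) * (\<Gamma> + 1)"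
        using \<open>\<Gamma> \<ge> 0\<close> by (intro mult_right_mono) (auto simp: c_def)
      also have "\<dots> = \<kappa>\<^sup>2 / (2 * L22)"
        using \<open>\<Gamma> \<ge> 0\<close> by (metis add_nonneg_pos divide_divide_eq_left less_irrefl nonzero_eq_divide_eq zero_less_one)
      finally have c: "c * (\<Gamma> + 1) \<le> \<kappa>\<^sup>2 / (2 * L22)" .
      have "\<rho> ^ K * (best (x t) - f (x t) (y t)) \<le> (c * \<epsilon>\<^sup>2) * (\<Gamma> + 1)"
        using K gap0[of t] gap[of t] \<open>c > 0\<close> by (intro mult_mono) auto
      also have "\<dots> = (c * (\<Gamma> + 1)) * \<epsilon>\<^sup>2" by simp
      also have "\<dots> \<le> (\<kappa>\<^sup>2 / (2 * L22)) * \<epsilon>\<^sup>2" using c by (intro mult_right_mono) auto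
      finally have "best (x t) - f (x t) (y (Suc t)) \<le> \<kappa>\<^sup>2 / (2 * L22) * \<epsilon>\<^sup>2"
        using gap_Suc[of t] by linarith
      then have "2 * L22 * (best (x t) - f (x t) (y (Suc t))) \<le> 2 * L22 * (\<kappa>\<^sup>2 / (2 * L22) * \<epsilon>\<^sup>2)"
        using pos by (intro mult_left_mono) auto
      also have "\<dots> = (\<kappa> * \<epsilon>)\<^sup>2" using pos by (simp add: power_mult_distrib)
      finally have "(norm (G\<^sub>\<alpha> (x t) (y (Suc t))))\<^sup>2 \<le> (\<kappa> * \<epsilon>)\<^sup>2"
        using gradient_le_gap[OF xS[of t], of "y (Suc t)"] by linarith
      then show ?thesis
        by (rule power2_le_imp_le) (use \<open>\<kappa> > 0\<close> \<epsilon> in auto)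
    qed
    have \<kappa>\<epsilon>: "\<kappa> * \<epsilon> \<le> \<epsilon>" "\<kappa> * \<epsilon> \<le> 1"
      using \<open>\<kappa> \<le> 1\<close> \<open>\<kappa> > 0\<close> \<epsilon> by (auto simp: mult_le_one)
    have small_step: "\<exists>t\<in>{0..T}. M * norm (x (Suc t) - x t) \<le> \<epsilon>"
    proof (rule ccontr)
      assume "\<not> ?thesis"
      then have big: "\<epsilon> / M < norm (x (Suc t) - x t)" if "t \<le> T" for t
        using that \<open>M > 0\<close> by (force simp: field_simps not_le)
      \<comment> \<open>A step longer than \<open>\<epsilon> / M\<close> gains at least
        \<open>2 * d\<close> and the error costs at most \<open>d / 2\<close>.\<close>
      define d where "d = L11 * \<epsilon>\<^sup>2 / (8 * M\<^sup>2)"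
      have "d > 0" using pos \<epsilon> \<open>M > 0\<close> by (simp add: d_def)
      have drop: "best (x (Suc t)) \<le> best (x t) - d" if t: "t \<le> T" for t
      proof -
        have "L12 / \<mu> * norm (G\<^sub>\<alpha> (x t) (y (Suc t))) \<le> L12 / \<mu> * (\<kappa> * \<epsilon>)"
          using \<delta>[of t] pos by (intro mult_left_mono) auto
        also have "\<dots> \<le> L11 / (4 * M) * \<epsilon>"
          using mult_right_mono[OF \<kappa>, of \<epsilon>] \<epsilon> by simp
        finally have "(L12 / \<mu> * norm (G\<^sub>\<alpha> (x t) (y (Suc t))))\<^sup>2 \<le> (L11 / (4 * M) * \<epsilon>)\<^sup>2"
          using pos by (intro power_mono) auto
        then have "(L12 / \<mu> * norm (G\<^sub>\<alpha> (x t) (y (Suc t))))\<^sup>2 / L11 \<le> (L11 / (4 * M) * \<epsilon>)\<^sup>2 / L11"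
          using pos by (intro divide_right_mono) auto
        also have "\<dots> = d / 2"
          using pos \<open>M > 0\<close> by (simp add: d_def field_simps power2_eq_square)
        finally have "(L12 / \<mu> * norm (G\<^sub>\<alpha> (x t) (y (Suc t))))\<^sup>2 / L11 \<le> d / 2" .
        moreover have "L11 / 4 * (\<epsilon> / M)\<^sup>2 \<le> L11 / 4 * (norm (x (Suc t) - x t))\<^sup>2"
          using big[OF t] pos \<epsilon> \<open>M > 0\<close> by (intro mult_left_mono power_mono) auto
        moreover have "L11 / 4 * (\<epsilon> / M)\<^sup>2 = 2 * d"
          by (simp add: d_def power_divide)
        ultimately show ?thesis
          using descent_step[OF xS[of t] L x_Suc[of t]] \<open>d > 0\<close> by linarith
      qed
      have "best (x n) \<le> best (x 0) - real n * d" if "n \<le> Suc T" for n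
        using that
      proof (induction n)
        case (Suc n)
        then show ?case using drop[of n] by (simp add: algebra_simps)
      qed simp
      \<comment> \<open>Indices 0 to \<open>T\<close> give \<open>T + 1\<close> decreases against a
        budget of at most \<open>real T * d\<close>; the extra one yields the contradiction, even if
        \<open>C0 = 0\<close>.\<close>
      from this[of "Suc T"] have "real (Suc T) * d \<le> C0"
        using C0(2)[OF xS[of "Suc T"] xS[of 0]] by simp
      moreover have "C0 = C / \<epsilon>\<^sup>2 * d"
        using pos \<epsilon> \<open>M > 0\<close> by (simp add: C_def d_def)
      moreover have "C / \<epsilon>\<^sup>2 * d \<le> real T * d"
        using T \<open>d > 0\<close> by (intro mult_right_mono) auto
      ultimately show False using \<open>d > 0\<close> by (simp add: algebra_simps)
    qed
    then obtain t where t: "t \<in> {0..T}" "M * norm (x (Suc t) - x t) \<le> \<epsilon>" ..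
    have "L12 / \<mu> * norm (G\<^sub>\<alpha> (x t) (y (Suc t))) \<le> L12 / \<mu> * 1"
      using \<delta>[of t] \<kappa>\<epsilon> pos by (intro mult_left_mono) auto
    then have "(B + L12 / \<mu> * norm (G\<^sub>\<alpha> (x t) (y (Suc t)))) * norm (x (Suc t) - x t)
        \<le> (B + L12 / \<mu>) * norm (x (Suc t) - x t)"
      by (intro mult_right_mono) auto
    then have "\<bar>G\<^sub>\<theta> (x t) (y (Suc t)) \<bullet> (x (Suc t) - x t)\<bar> \<le> (B + L12 / \<mu>) * norm (x (Suc t) - x t)"
      using B(2)[OF xS xS, of t "y (Suc t)" "Suc t"] by linarith
    from nash_gap_min_le[OF xS \<open>L > 0\<close> x_Suc this]
    have "nash_gap_min S G\<^sub>\<theta> (x t) (y (Suc t)) \<le> \<epsilon>"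
      using t by (simp add: M_def)
    moreover have "nash_gap_max UNIV G\<^sub>\<alpha> (x t) (y (Suc t)) \<le> \<epsilon>"
      using nash_gap_max_le[of "x t" "y (Suc t)"] \<delta>[of t] \<kappa>\<epsilon> by linarith
    ultimately have "first_order_nash S UNIV G\<^sub>\<theta> G\<^sub>\<alpha> \<epsilon> (x t) (y (Suc t))"
      using xS by (simp add: first_order_nash_def)
    with t(1) show "\<exists>t\<in>{0..T}. first_order_nash S UNIV G\<^sub>\<theta> G\<^sub>\<alpha> \<epsilon>
         (fst (multistep_gda S G\<^sub>\<theta> G\<^sub>\<alpha> (1 / L22) (1 / L) K x0 y0 t))
         (snd (multistep_gda S G\<^sub>\<theta> G\<^sub>\<alpha> (1 / L22) (1 / L) K x0 y0 (Suc t)))"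
      unfolding x_def y_def by blast
  qed
qed

end

section \<open>Thresholds in terms of \<epsilon> and the final result\<close>

lemma power_le_of_log_threshold:
  fixes \<rho> c \<epsilon> :: real
  assumes "0 < \<rho>" "\<rho> < 1" "0 < c" "0 < \<epsilon>"
    and K: "(ln (1 / c) + 2 * ln (1 / \<epsilon>)) / ln (1 / \<rho>) \<le> real K"
  shows "\<rho> ^ K \<le> c * \<epsilon>\<^sup>2"
proof -
  have "ln (1 / \<rho>) > 0" using assms by simp
  then have "ln (1 / c) + 2 * ln (1 / \<epsilon>) \<le> real K * ln (1 / \<rho>)"
    using K by (simp add: pos_divide_le_eq)
  then have "ln (\<rho> ^ K) \<le> ln (c * \<epsilon>\<^sup>2)"
    using assms by (simp add: ln_mult ln_realpow ln_div)
  then show ?thesis using assms by simp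
qed

lemma affine_log_bigo:
  "(\<lambda>\<epsilon>::real. (a + b * ln (1 / \<epsilon>)) / d) \<in> O[at_right 0](\<lambda>\<epsilon>. ln (1 / \<epsilon>))"
proof -
  have "filterlim (\<lambda>\<epsilon>::real. ln (1 / \<epsilon>)) at_top (at_right 0)"
    using filterlim_compose[OF ln_at_top filterlim_inverse_at_top_right]
    by (simp add: inverse_eq_divide)
  then have "(\<lambda>\<epsilon>::real. a) \<in> O[at_right 0](\<lambda>\<epsilon>. ln (1 / \<epsilon>))"
    by (intro landau_o.small_imp_big smalloI_tendsto)
      (auto intro!: real_tendsto_divide_at_top tendsto_const simp: filterlim_at_top_dense
        elim!: eventually_mono)
  then have "(\<lambda>\<epsilon>::real. a + b * ln (1 / \<epsilon>)) \<in> O[at_right 0](\<lambda>\<epsilon>. ln (1 / \<epsilon>))"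
    by (intro sum_in_bigo) auto
  \<comment> \<open>For \<open>d = 0\<close> the quotient is 0 by convention.\<close>
  then show ?thesis by (cases "d = 0") auto
qed

theorem theorem3p4:
  fixes S :: "(real ^ 'm) set" and A :: "(real ^ 'n) set"
    and c :: "real ^ 'm" and R :: real
    and f :: "real ^ 'm \<Rightarrow> real ^ 'n \<Rightarrow> real"
    and G\<^sub>\<theta> :: "real ^ 'm \<Rightarrow> real ^ 'n \<Rightarrow> real ^ 'm"
    and G\<^sub>\<alpha> :: "real ^ 'm \<Rightarrow> real ^ 'n \<Rightarrow> real ^ 'n"
    and L11 L22 L12 L \<mu> \<eta>1 \<eta>2 :: real
    and \<theta>0 :: "real ^ 'm" and \<alpha>0 :: "real ^ 'n"
  assumes "convex S" and "compact S" and "S \<subseteq> cball c R"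
    and "A = UNIV"
    and "C1_partial_gradients S A f G\<^sub>\<theta> G\<^sub>\<alpha>"
    and "L11 > 0" and "L22 > 0"
    and "\<And>\<theta>1 \<theta>2 \<alpha>. \<lbrakk>\<theta>1 \<in> S; \<theta>2 \<in> S; \<alpha> \<in> A\<rbrakk> \<Longrightarrow>
           norm (G\<^sub>\<theta> \<theta>1 \<alpha> - G\<^sub>\<theta> \<theta>2 \<alpha>) \<le> L11 * norm (\<theta>1 - \<theta>2)"
    and "\<And>\<theta> \<alpha>1 \<alpha>2. \<lbrakk>\<theta> \<in> S; \<alpha>1 \<in> A; \<alpha>2 \<in> A\<rbrakk> \<Longrightarrow>
           norm (G\<^sub>\<alpha> \<theta> \<alpha>1 - G\<^sub>\<alpha> \<theta> \<alpha>2) \<le> L22 * norm (\<alpha>1 - \<alpha>2)"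
    and "\<And>\<theta>1 \<theta>2 \<alpha>. \<lbrakk>\<theta>1 \<in> S; \<theta>2 \<in> S; \<alpha> \<in> A\<rbrakk> \<Longrightarrow>
           norm (G\<^sub>\<alpha> \<theta>1 \<alpha> - G\<^sub>\<alpha> \<theta>2 \<alpha>) \<le> L12 * norm (\<theta>1 - \<theta>2)"
    and "\<And>\<theta> \<alpha>1 \<alpha>2. \<lbrakk>\<theta> \<in> S; \<alpha>1 \<in> A; \<alpha>2 \<in> A\<rbrakk> \<Longrightarrow>
           norm (G\<^sub>\<theta> \<theta> \<alpha>1 - G\<^sub>\<theta> \<theta> \<alpha>2) \<le> L12 * norm (\<alpha>1 - \<alpha>2)"
    and "\<mu> > 0" and "\<And>\<theta>. \<theta> \<in> S \<Longrightarrow> PL \<mu> (\<lambda>\<alpha>. - f \<theta> \<alpha>)"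
    and "\<theta>0 \<in> S" and "\<alpha>0 \<in> A"
    and "L = L11 + L12\<^sup>2 / (2 * \<mu>)" and "\<eta>1 = 1 / L22" and "\<eta>2 = 1 / L"
  shows "\<exists>N\<^sub>T N\<^sub>K :: real \<Rightarrow> real.
           N\<^sub>T \<in> O[at_right 0](\<lambda>\<epsilon>. 1 / \<epsilon>\<^sup>2) \<and>
           N\<^sub>K \<in> O[at_right 0](\<lambda>\<epsilon>. ln (1 / \<epsilon>)) \<and>
           (\<forall>\<epsilon> T K. 0 < \<epsilon> \<longrightarrow> \<epsilon> < 1 \<longrightarrow> real T \<ge> N\<^sub>T \<epsilon> \<longrightarrow> real K \<ge> N\<^sub>K \<epsilon> \<longrightarrow>
              (\<exists>t\<in>{0..T}.
                 first_order_nash S A G\<^sub>\<theta> G\<^sub>\<alpha> \<epsilon>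
                   (fst (multistep_gda S G\<^sub>\<theta> G\<^sub>\<alpha> \<eta>1 \<eta>2 K \<theta>0 \<alpha>0 t))
                   (snd (multistep_gda S G\<^sub>\<theta> G\<^sub>\<alpha> \<eta>1 \<eta>2 K \<theta>0 \<alpha>0 (Suc t)))))"
proof -
  have A: "A = UNIV" by fact
  note C1 = assms(5)[unfolded C1_partial_gradients_def A]
  \<comment> \<open>The Lipschitz bound is tested on two points at distance 1, namely 0 and a basis
    vector.\<close>
  have "L12 \<ge> 0"
  proof -
    have "0 \<le> norm (G\<^sub>\<theta> \<theta>0 0 - G\<^sub>\<theta> \<theta>0 ((SOME b. b \<in> Basis)))" by simp
    also have "\<dots> \<le> L12 * norm (0 - (SOME b. b \<in> Basis) :: real ^ 'n)"
      by (rule assms) (use assms in auto)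
    finally show ?thesis by (simp add: SOME_Basis)
  qed
  have deriv: "((\<lambda>y. f x y) has_derivative (\<lambda>v. inner (G\<^sub>\<alpha> x y) v)) (at y)" if "x \<in> S" for x y
    using C1 that by auto
  interpret smooth_PL_game S f G\<^sub>\<theta> G\<^sub>\<alpha> L11 L22 L12 \<mu> "2 * R"
  proof
    show "norm (x' - x) \<le> 2 * R" if "x \<in> S" "x' \<in> S" for x x'
    proof -
      have "dist c x \<le> R" "dist c x' \<le> R" using that \<open>S \<subseteq> cball c R\<close> by auto
      then show ?thesis using dist_triangle3[of x' x c] by (simp add: dist_norm)
    qed
    show "\<exists>a. \<forall>y. f x y \<le> f x a \<and> \<mu> * (f x a - f x y) \<le> 1 / 2 * (norm (G\<^sub>\<alpha> x y))\<^sup>2"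
      if x: "x \<in> S" for x
    proof -
      obtain Dh a where Dh: "\<And>y. GDERIV (\<lambda>y. - f x y) y :> Dh y"
        and a: "\<And>y. - f x a \<le> - f x y"
          "\<And>y. 1 / 2 * (norm (Dh y))\<^sup>2 \<ge> \<mu> * (- f x y - - f x a)"
        using assms(13)[OF x] unfolding PL_def by blast
      \<comment> \<open>\<open>PL\<close> brings its own gradient; uniqueness of the derivative on
        the whole space identifies it with the given one.\<close>
      have "Dh y = - G\<^sub>\<alpha> x y" for y
      proof -
        have "((\<lambda>y. - f x y) has_derivative (\<lambda>v. inner v (Dh y))) (at y)"
          using Dh[of y] by (simp add: gderiv_def)
        moreover have "((\<lambda>y. - f x y) has_derivative (\<lambda>v. - inner (G\<^sub>\<alpha> x y) v)) (at y)"
          by (intro has_derivative_minus deriv x)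
        ultimately have "(\<lambda>v. inner v (Dh y)) = (\<lambda>v. - inner (G\<^sub>\<alpha> x y) v)"
          by (rule has_derivative_unique)
        then have "inner v (Dh y) = inner v (- G\<^sub>\<alpha> x y)" for v
          by (metis inner_commute inner_minus_right)
        then show ?thesis by (metis inner_commute vector_eq_ldot)
      qed
      then have "f x y \<le> f x a \<and> \<mu> * (f x a - f x y) \<le> 1 / 2 * (norm (G\<^sub>\<alpha> x y))\<^sup>2" for y
        using a[of y] by (simp add: algebra_simps)
      then show ?thesis by blast
    qed
  qed (use assms C1 deriv \<open>L12 \<ge> 0\<close> in \<open>auto simp: compact_imp_closed\<close>)
  text \<open>
    If \<open>\<alpha> \<mapsto> f \<theta> \<alpha>\<close> is constant for all \<open>\<theta>\<close>, then \<open>\<mu>\<close> may exceed \<open>L22\<close> and \<open>1 - \<mu> / L22\<close> may be negative.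
  \<close>
  define \<rho> where "\<rho> = max (1 / 2) (1 - \<mu> / L22)"
  have \<rho>: "0 < \<rho>" "\<rho> < 1" "\<rho> \<ge> 0" "\<rho> \<ge> 1 - \<mu> / L22"
    using pos by (auto simp: \<rho>_def)
  obtain C d where C: "C \<ge> 0" "d > 0"
    "\<And>\<epsilon> T K. 0 < \<epsilon> \<Longrightarrow> \<epsilon> < 1 \<Longrightarrow> C / \<epsilon>\<^sup>2 \<le> real T \<Longrightarrow> \<rho> ^ K \<le> d * \<epsilon>\<^sup>2 \<Longrightarrow>
       \<exists>t\<in>{0..T}. first_order_nash S UNIV G\<^sub>\<theta> G\<^sub>\<alpha> \<epsilon>
         (fst (multistep_gda S G\<^sub>\<theta> G\<^sub>\<alpha> (1 / L22) (1 / L) K \<theta>0 \<alpha>0 t))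
         (snd (multistep_gda S G\<^sub>\<theta> G\<^sub>\<alpha> (1 / L22) (1 / L) K \<theta>0 \<alpha>0 (Suc t)))"
    using nash_iterate[OF \<open>\<theta>0 \<in> S\<close> \<open>L = L11 + L12\<^sup>2 / (2 * \<mu>)\<close> \<rho>(3,4), of \<alpha>0] by blast
  show ?thesis
  proof (rule exI[of _ "\<lambda>\<epsilon>. C / \<epsilon>\<^sup>2"],
      rule exI[of _ "\<lambda>\<epsilon>. (ln (1 / d) + 2 * ln (1 / \<epsilon>)) / ln (1 / \<rho>)"], intro conjI allI impI)
    show "(\<lambda>\<epsilon>. C / \<epsilon>\<^sup>2) \<in> O[at_right 0](\<lambda>\<epsilon>. 1 / \<epsilon>\<^sup>2)"
      by (rule bigoI[of _ C]) (use \<open>C \<ge> 0\<close> in simp)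
    show "(\<lambda>\<epsilon>. (ln (1 / d) + 2 * ln (1 / \<epsilon>)) / ln (1 / \<rho>)) \<in> O[at_right 0](\<lambda>\<epsilon>. ln (1 / \<epsilon>))"
      by (rule affine_log_bigo)
  next
    fix \<epsilon> :: real and T K :: nat
    assume "0 < \<epsilon>" "\<epsilon> < 1" "C / \<epsilon>\<^sup>2 \<le> real T"
      "(ln (1 / d) + 2 * ln (1 / \<epsilon>)) / ln (1 / \<rho>) \<le> real K"
    then show "\<exists>t\<in>{0..T}. first_order_nash S A G\<^sub>\<theta> G\<^sub>\<alpha> \<epsilon>
        (fst (multistep_gda S G\<^sub>\<theta> G\<^sub>\<alpha> \<eta>1 \<eta>2 K \<theta>0 \<alpha>0 t))
        (snd (multistep_gda S G\<^sub>\<theta> G\<^sub>\<alpha> \<eta>1 \<eta>2 K \<theta>0 \<alpha>0 (Suc t)))"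
      unfolding \<open>A = UNIV\<close> \<open>\<eta>1 = 1 / L22\<close> \<open>\<eta>2 = 1 / L\<close>
      using C power_le_of_log_threshold[OF \<rho>(1,2) \<open>d > 0\<close>] by blast
  qed
qed

end
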